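(* The number $SB_n$ of semi-Baxter permutations of size $n$ satisfies, for all $n\geq 2$: $$\begin{aligned}SB_n=\frac{1}{n-1}\sum_{j=0}^{n}\binom{n-1}{j}\Biggl[&\binom{n-1}{j+1}\left[\binom{n+j+1}{j+5}+2\binom{n+j+1}{j}\right]\\&+2\binom{n-1}{j+2}\left[-\binom{n+j+2}{j+5}+\binom{n+j+1}{j+3}-\binom{n+j+2}{j+2}+\binom{n+j+1}{j}\right]\\&+3\binom{n-1}{j+3}\left[\binom{n+j+2}{j+4}-\binom{n+j+2}{j+2}\right]\Biggr].\end{aligned}$$
   Context: A permutation $\pi$ of $\{1,\dots,n\}$ is semi-Baxter if there are no indices $i<j$ and $k>j+1$ such that $\pi_{j+1}<\pi_i<\pi_k<\pi_j$. Binomial coefficients $\binom{m}{r}$ are $0$ when $r>m\geq 0$. *)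

theory Defs
  imports Complex_Main "HOL-Combinatorics.Permutations"
begin

definition semi_baxter :: "nat \<Rightarrow> (nat \<Rightarrow> nat) \<Rightarrow> bool" where
  "semi_baxter n \<pi> \<longleftrightarrow>
     \<pi> permutes {1..n} \<and>
     \<not> (\<exists>i\<in>{1..n}. \<exists>j\<in>{1..n}. \<exists>k\<in>{1..n}.
           i < j \<and> k > j + 1 \<and>
           \<pi> (j + 1) < \<pi> i \<and> \<pi> i < \<pi> k \<and> \<pi> k < \<pi> j)"

definition SB :: "nat \<Rightarrow> nat" where
  "SB n = card {\<pi>. semi_baxter n \<pi>}"

end

theory Submission
  imports Defs "HOL-Computational_Algebra.Formal_Laurent_Series"
begin

text \<open>
  Deleting the last entry of a semi-Baxter permutation leaves a semi-Baxter permutation. Which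
  values may be appended to one of size n is controlled by two numbers: the number h of admissible
  values that are at most its last entry, and the number k of larger ones. They evolve by the
  succession rule (h, k) to (i, k + 1) for i = 1..h and (h + i, k + 1 - i) for i = 1..k, so SB n
  counts the nodes at depth n - 1 of the generating tree with root label (1, 1)
  (\<open>SB_eq_tree_count\<close>).

  The tree is counted by the kernel method, arranged so that no generating function has to be
  solved for. Write a = h - 1, b = k - 1 and encode the label (h, k) by the monomial y^a z^b. The
  children of a node then add up to

    X y^a z^b - z^(b+1) / (y - 1) - y^(a+b+2) / (z - y),   X = y z (z - 1) / ((y - 1) (z - y)).

  Without the two boundary terms, iterating the rule would simply produce powers of X. Up to
  their denominators, the first boundary term is a function of z alone and the second one a function
  of y alone. Now X is invariant under the involutions (y, z) to (z / y, z) and (y, z) to (y, y (z - 1) / (z - y));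
  the first one fixes z and the second one fixes y. Starting from a generic point and applying them
  alternately gives five points such that in a suitable linear combination of the values there (the
  functional \<open>orbit_sum\<close>) the boundary terms cancel between neighbouring points. Only two survive, one at
  each end of the chain: a power of y, and a function of y divided by X
  (\<open>orbit_sum_children\<close>).

  Let u = y - 1 and v = z - y, and let X' be the derivative of X with respect to v. The iterated
  residue in v and u of - (X' / u) X^m F annihilates both survivors. If F depends on u only, then
  X' X^m F is a derivative in v. If F is divided by X as well, this still works for m > 0, while for
  m = 0 the residue of X' / X is a constant and the remaining Laurent polynomial in u has no term
  with exponent -1. So this residue, evaluated at the orbit sum of y^a z^b, satisfies the recurrence
  of the tree and counts the descendants m levels below a node with label (h, k)
  (\<open>tree_count_eq_residue\<close>).

  At the root, X times the orbit sum is a cubic polynomial Q in v (\<open>orbit_sum_one\<close>). Integration by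
  parts, which is Lagrange inversion in disguise, replaces X' X^(N-1) Q by - X^N Q' / N where N = n - 1;
  this explains the factor 1 / (n - 1), and the three coefficients of Q' with their factors 1, 2, 3
  are the three groups of terms of the formula. The sum over j is the binomial expansion of
  X^N = ((1 + u) (1 + u + v) (u + v) / (u v))^N.
\<close>

section \<open>Semi-Baxter permutations and the generating tree\<close>

definition append_value :: "nat \<Rightarrow> (nat \<Rightarrow> nat) \<Rightarrow> nat \<Rightarrow> nat \<Rightarrow> nat" where
  "append_value n \<pi> a i =
     (if i \<in> {1..n} then (if \<pi> i < a then \<pi> i else Suc (\<pi> i))
      else if i = Suc n then a else i)"

text \<open>
  A value is active if appending it creates no forbidden pattern. In such a pattern the new entry
  must play the part of the last one, because the middle two are adjacent and not last.
  The comparison with \<open>\<pi> j\<close> is not strict: an entry equal to \<open>a\<close> moves up to \<open>Suc a\<close>.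
\<close>

definition active :: "nat \<Rightarrow> (nat \<Rightarrow> nat) \<Rightarrow> nat set" where
  "active n \<pi> = {a \<in> {1..Suc n}.
     \<not> (\<exists>i j. 1 \<le> i \<and> i < j \<and> j < n \<and> \<pi> (Suc j) < \<pi> i \<and> \<pi> i < a \<and> a \<le> \<pi> j)}"

definition low_label :: "nat \<Rightarrow> (nat \<Rightarrow> nat) \<Rightarrow> nat" where
  "low_label n \<pi> = card {a \<in> active n \<pi>. a \<le> \<pi> n}"

definition high_label :: "nat \<Rightarrow> (nat \<Rightarrow> nat) \<Rightarrow> nat" where
  "high_label n \<pi> = card {a \<in> active n \<pi>. \<pi> n < a}"

fun tree_count :: "nat \<Rightarrow> nat \<Rightarrow> nat \<Rightarrow> nat" where
  "tree_count 0 h k = 1"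
| "tree_count (Suc m) h k =
     (\<Sum>i=1..h. tree_count m i (Suc k)) + (\<Sum>i=1..k. tree_count m (h + i) (Suc k - i))"

lemma append_value_last: "append_value n \<pi> a (Suc n) = a"
  by (simp add: append_value_def)

lemma permutes_range:
  assumes "\<pi> permutes {1..n::nat}" "1 \<le> i" "i \<le> n"
  shows "1 \<le> \<pi> i" "\<pi> i \<le> n"
  using permutes_in_image[OF assms(1), of i] assms(2,3) by auto

lemma permutes_eq_iff:
  assumes "\<pi> permutes S"
  shows "\<pi> i = \<pi> j \<longleftrightarrow> i = j"
  using permutes_inj[OF assms] by (auto simp: inj_def)

lemma append_value_permutes:
  assumes p: "\<pi> permutes {1..n}" and a: "a \<in> {1..Suc n}"
  shows "append_value n \<pi> a permutes {1..Suc n}"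
proof -
  have inj: "inj_on (append_value n \<pi> a) {1..Suc n}"
  proof (rule inj_onI)
    fix i j assume "i \<in> {1..Suc n}" "j \<in> {1..Suc n}" "append_value n \<pi> a i = append_value n \<pi> a j"
    then show "i = j"
      using permutes_eq_iff[OF p, of i j]
      by (auto simp: append_value_def split: if_splits)
  qed
  have sub: "append_value n \<pi> a ` {1..Suc n} \<subseteq> {1..Suc n}"
    using a permutes_range[OF p] by (force simp: append_value_def)
  show ?thesis
  proof (rule bij_imp_permutes)
    show "bij_betw (append_value n \<pi> a) {1..Suc n} {1..Suc n}"
      using inj endo_inj_surj[OF _ sub inj] by (auto simp: bij_betw_def)
  qed (auto simp: append_value_def)
qed

lemma append_value_surj:
  assumes s: "\<sigma> permutes {1..Suc n}"
  obtains \<pi> where "\<pi> permutes {1..n}" "append_value n \<pi> (\<sigma> (Suc n)) = \<sigma>"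
proof -
  define a where "a = \<sigma> (Suc n)"
  define \<pi> where "\<pi> i = (if i \<in> {1..n} then (if \<sigma> i < a then \<sigma> i else \<sigma> i - 1) else i)" for i
  have ne: "\<sigma> i \<noteq> a" if "i \<in> {1..n}" for i
    using that permutes_eq_iff[OF s, of i "Suc n"] by (auto simp: a_def)
  have a: "1 \<le> a" "a \<le> Suc n" using permutes_range[OF s, of "Suc n"] by (auto simp: a_def)
  have rng: "1 \<le> \<sigma> i \<and> \<sigma> i \<le> Suc n" if "i \<in> {1..n}" for i
    using that permutes_range[OF s, of i] by auto
  have inj: "inj_on \<pi> {1..n}"
  proof (rule inj_onI)
    fix i j assume ij: "i \<in> {1..n}" "j \<in> {1..n}" "\<pi> i = \<pi> j"
    then have "\<sigma> i = \<sigma> j"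
      using ne[of i] ne[of j] by (auto simp: \<pi>_def split: if_splits)
    then show "i = j" using permutes_eq_iff[OF s] by simp
  qed
  have sub: "\<pi> ` {1..n} \<subseteq> {1..n}"
  proof
    fix b assume "b \<in> \<pi> ` {1..n}"
    then obtain i where i: "i \<in> {1..n}" "b = \<pi> i" by auto
    show "b \<in> {1..n}" using i rng[OF i(1)] ne[OF i(1)] a by (auto simp: \<pi>_def)
  qed
  have "\<pi> permutes {1..n}"
  proof (rule bij_imp_permutes)
    show "bij_betw \<pi> {1..n} {1..n}"
      using inj endo_inj_surj[OF _ sub inj] by (auto simp: bij_betw_def)
  qed (auto simp: \<pi>_def)
  moreover have "append_value n \<pi> (\<sigma> (Suc n)) = \<sigma>"
  proof
    fix i
    consider "i \<in> {1..n}" | "i = Suc n" | "i \<notin> {1..Suc n}" by fastforce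
    then show "append_value n \<pi> (\<sigma> (Suc n)) i = \<sigma> i"
    proof cases
      case 1
      then show ?thesis using ne[OF 1] by (auto simp: append_value_def \<pi>_def a_def)
    next
      case 2
      then show ?thesis by (simp add: append_value_def)
    next
      case 3
      then show ?thesis using permutes_not_in[OF s 3] by (auto simp: append_value_def)
    qed
  qed
  ultimately show thesis using that by blast
qed

lemma append_value_inj:
  assumes p: "\<pi> permutes {1..n}" and q: "\<rho> permutes {1..n}"
    and eq: "append_value n \<pi> a = append_value n \<rho> b"
  shows "\<pi> = \<rho>" "a = b"
proof -
  show ab: "a = b" using append_value_last eq by metis
  show "\<pi> = \<rho>"
  proof
    fix i
    show "\<pi> i = \<rho> i"
    proof (cases "i \<in> {1..n}")
      case True
      then show ?thesis using fun_cong[OF eq, of i] ab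
        by (auto simp: append_value_def split: if_splits)
    next
      case False
      then show ?thesis using permutes_not_in[OF p] permutes_not_in[OF q] by simp
    qed
  qed
qed

lemma append_value_less_iff:
  assumes "i \<in> {1..n}" "j \<in> {1..n}"
  shows "append_value n \<pi> a i < append_value n \<pi> a j \<longleftrightarrow> \<pi> i < \<pi> j"
  using assms by (auto simp: append_value_def)

lemma append_value_less_last_iff:
  assumes "i \<in> {1..n}"
  shows "append_value n \<pi> a i < a \<longleftrightarrow> \<pi> i < a" "a < append_value n \<pi> a i \<longleftrightarrow> a \<le> \<pi> i"
  using assms by (auto simp: append_value_def)

lemma semi_baxter_append_value_iff:
  assumes p: "\<pi> permutes {1..n}" and a: "a \<in> {1..Suc n}"
  shows "semi_baxter (Suc n) (append_value n \<pi> a) \<longleftrightarrow> semi_baxter n \<pi> \<and> a \<in> active n \<pi>"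
proof -
  let ?\<sigma> = "append_value n \<pi> a"
  let ?occ = "\<lambda>\<tau> i j k. i < j \<and> k > j + 1 \<and> \<tau> (j + 1) < \<tau> i \<and> \<tau> i < \<tau> k \<and> \<tau> k < \<tau> j"
  have old: "?occ ?\<sigma> i j k \<longleftrightarrow> ?occ \<pi> i j k" if "i \<in> {1..Suc n}" "k \<in> {1..n}" for i j k
  proof (cases "i < j \<and> j + 1 < k")
    case True
    then have "i \<in> {1..n}" "j \<in> {1..n}" "j + 1 \<in> {1..n}" using that by auto
    then show ?thesis using that by (simp only: append_value_less_iff)
  qed auto
  have new: "?occ ?\<sigma> i j (Suc n) \<longleftrightarrow>
      i < j \<and> j < n \<and> \<pi> (Suc j) < \<pi> i \<and> \<pi> i < a \<and> a \<le> \<pi> j" if "i \<in> {1..Suc n}" for i j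
    using that append_value_less_iff[of "Suc j" n i] append_value_less_last_iff[of i n]
      append_value_less_last_iff[of j n]
    by (auto simp: append_value_last)
  have "(\<exists>i\<in>{1..Suc n}. \<exists>j\<in>{1..Suc n}. \<exists>k\<in>{1..Suc n}. ?occ ?\<sigma> i j k) \<longleftrightarrow>
     (\<exists>i\<in>{1..n}. \<exists>j\<in>{1..n}. \<exists>k\<in>{1..n}. ?occ \<pi> i j k) \<or> a \<notin> active n \<pi>" (is "?L \<longleftrightarrow> ?R")
  proof
    assume ?L
    then obtain i j k where ijk: "i \<in> {1..Suc n}" "j \<in> {1..Suc n}" "k \<in> {1..Suc n}" "?occ ?\<sigma> i j k"
      by blast
    show ?R
    proof (cases "k = Suc n")
      case True
      then have "a \<notin> active n \<pi>" using new[OF ijk(1), of j] ijk by (auto simp: active_def)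
      then show ?thesis by blast
    next
      case False
      then have k: "k \<in> {1..n}" using ijk by auto
      then have "?occ \<pi> i j k" using old[OF ijk(1) k, of j] ijk by blast
      moreover have "i \<in> {1..n}" "j \<in> {1..n}" using ijk k by auto
      ultimately show ?thesis using k by blast
    qed
  next
    assume ?R
    then show ?L
    proof
      assume "\<exists>i\<in>{1..n}. \<exists>j\<in>{1..n}. \<exists>k\<in>{1..n}. ?occ \<pi> i j k"
      then obtain i j k where ijk: "i \<in> {1..n}" "j \<in> {1..n}" "k \<in> {1..n}" "?occ \<pi> i j k"
        by blast
      then have m: "i \<in> {1..Suc n}" "j \<in> {1..Suc n}" "k \<in> {1..Suc n}" by auto
      have "?occ ?\<sigma> i j k" using old[OF m(1) ijk(3), of j] ijk(4) by blast
      then show ?L using m by blast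
    next
      assume "a \<notin> active n \<pi>"
      then obtain i j where ij: "1 \<le> i" "i < j" "j < n" "\<pi> (Suc j) < \<pi> i" "\<pi> i < a" "a \<le> \<pi> j"
        using a by (auto simp: active_def)
      then have m: "i \<in> {1..Suc n}" "j \<in> {1..Suc n}" "Suc n \<in> {1..Suc n}" by auto
      have "?occ ?\<sigma> i j (Suc n)" using new[OF m(1), of j] ij by blast
      then show ?L using m by blast
    qed
  qed
  then show ?thesis
    using p append_value_permutes[OF p a] unfolding semi_baxter_def by blast
qed

lemma active_subset: "active n \<pi> \<subseteq> {1..Suc n}"
  by (auto simp: active_def)

lemma finite_active: "finite (active n \<pi>)"
  using active_subset finite_subset by blast

lemma finite_semi_baxter: "finite {\<pi>. semi_baxter n \<pi>}"
  by (rule finite_subset[OF _ finite_permutations[of "{1..n}"]]) (auto simp: semi_baxter_def)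

lemma bij_betw_append_value:
  "bij_betw (\<lambda>(\<pi>, a). append_value n \<pi> a)
     (SIGMA \<pi>:{\<pi>. semi_baxter n \<pi>}. active n \<pi>) {\<sigma>. semi_baxter (Suc n) \<sigma>}"
proof (rule bij_betwI')
  fix x y assume xy: "x \<in> (SIGMA \<pi>:{\<pi>. semi_baxter n \<pi>}. active n \<pi>)"
    "y \<in> (SIGMA \<pi>:{\<pi>. semi_baxter n \<pi>}. active n \<pi>)"
  obtain \<pi> a \<rho> b where e: "x = (\<pi>, a)" "y = (\<rho>, b)" by (cases x, cases y)
  show "((case x of (\<pi>, a) \<Rightarrow> append_value n \<pi> a) = (case y of (\<pi>, a) \<Rightarrow> append_value n \<pi> a)) = (x = y)"
    using xy append_value_inj[of \<pi> n \<rho> a b] by (auto simp: e semi_baxter_def)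
next
  fix x assume "x \<in> (SIGMA \<pi>:{\<pi>. semi_baxter n \<pi>}. active n \<pi>)"
  then obtain \<pi> a where e: "x = (\<pi>, a)" "semi_baxter n \<pi>" "a \<in> active n \<pi>" by auto
  moreover have "a \<in> {1..Suc n}" using e(3) active_subset by blast
  moreover have "\<pi> permutes {1..n}" using e(2) by (simp add: semi_baxter_def)
  ultimately show "(case x of (\<pi>, a) \<Rightarrow> append_value n \<pi> a) \<in> {\<sigma>. semi_baxter (Suc n) \<sigma>}"
    using semi_baxter_append_value_iff by simp
next
  fix \<sigma> assume "\<sigma> \<in> {\<sigma>. semi_baxter (Suc n) \<sigma>}"
  then have s: "semi_baxter (Suc n) \<sigma>" by simp
  then have perm: "\<sigma> permutes {1..Suc n}" by (simp add: semi_baxter_def)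
  obtain \<pi> where pi: "\<pi> permutes {1..n}" "append_value n \<pi> (\<sigma> (Suc n)) = \<sigma>"
    by (rule append_value_surj[OF perm])
  have "\<sigma> (Suc n) \<in> {1..Suc n}" using permutes_range[OF perm, of "Suc n"] by simp
  then have "semi_baxter n \<pi> \<and> \<sigma> (Suc n) \<in> active n \<pi>"
    using semi_baxter_append_value_iff[OF pi(1)] s pi(2) by metis
  then show "\<exists>x\<in>SIGMA \<pi>:{\<pi>. semi_baxter n \<pi>}. active n \<pi>. \<sigma> = (case x of (\<pi>, a) \<Rightarrow> append_value n \<pi> a)"
    using pi(2) by (intro bexI[of _ "(\<pi>, \<sigma> (Suc n))"]) auto
qed

text \<open>
  Site \<open>b\<close> of the longer permutation stems from site \<open>b\<close> or \<open>b - 1\<close> of the shorter one, where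
  \<open>a\<close> and \<open>Suc a\<close> both stem from \<open>a\<close>. The patterns that are new have the two last entries in the middle,
  so they need a descent, and then the value \<open>a\<close> of the shorter permutation, which has moved
  to \<open>Suc a\<close>, serves as their first entry. Hence exactly the sites above \<open>Suc a\<close> and up to
  the former last entry, which is now \<open>Suc (\<pi> n)\<close>, are lost; for an ascent there are none.
\<close>

lemma active_append_value:
  assumes n: "n \<ge> 1" and p: "\<pi> permutes {1..n}" and a: "a \<in> {1..Suc n}"
  shows "b \<in> active (Suc n) (append_value n \<pi> a) \<longleftrightarrow>
     (if b \<le> a then b else b - 1) \<in> active n \<pi> \<and> (Suc a < b \<longrightarrow> Suc (\<pi> n) < b)"
proof -
  let ?\<sigma> = "append_value n \<pi> a" and ?b = "if b \<le> a then b else b - 1"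
  have old: "(?\<sigma> (Suc j) < ?\<sigma> i \<and> ?\<sigma> i < b \<and> b \<le> ?\<sigma> j) \<longleftrightarrow>
      (\<pi> (Suc j) < \<pi> i \<and> \<pi> i < ?b \<and> ?b \<le> \<pi> j)" if "1 \<le> i" "i < j" "j < n" for i j
    using that append_value_less_iff[of "Suc j" n i] by (auto simp: append_value_def)
  have new: "(\<exists>i. 1 \<le> i \<and> i < n \<and> a < ?\<sigma> i \<and> ?\<sigma> i < b \<and> b \<le> ?\<sigma> n) \<longleftrightarrow>
      Suc a < b \<and> b \<le> Suc (\<pi> n)" (is "?L \<longleftrightarrow> ?R")
  proof
    assume ?L
    then show ?R using n by (auto simp: append_value_def split: if_splits)
  next
    assume R: ?R
    then have "a \<in> {1..n}" using a permutes_range[OF p n order_refl] by auto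
    then have "a \<in> \<pi> ` {1..n}" by (simp only: permutes_image[OF p])
    then obtain i where i: "i \<in> {1..n}" "a = \<pi> i" by auto
    \<comment> \<open>The entry a lies before position n, since the last entry is larger than a here.\<close>
    have "i \<noteq> n" using R i by auto
    then have "1 \<le> i \<and> i < n \<and> a < ?\<sigma> i \<and> ?\<sigma> i < b \<and> b \<le> ?\<sigma> n"
      using i R n by (auto simp: append_value_def)
    then show ?L by blast
  qed
  have rng: "b \<in> {1..Suc (Suc n)} \<longleftrightarrow> ?b \<in> {1..Suc n}" using a by auto
  have split: "(\<exists>i j. 1 \<le> i \<and> i < j \<and> j < Suc n \<and> ?\<sigma> (Suc j) < ?\<sigma> i \<and> ?\<sigma> i < b \<and> b \<le> ?\<sigma> j) \<longleftrightarrow>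
      (\<exists>i j. 1 \<le> i \<and> i < j \<and> j < n \<and> \<pi> (Suc j) < \<pi> i \<and> \<pi> i < ?b \<and> ?b \<le> \<pi> j) \<or>
      Suc a < b \<and> b \<le> Suc (\<pi> n)" (is "?S \<longleftrightarrow> ?T \<or> _")
  proof -
    have split_last: "(\<exists>i j. 1 \<le> i \<and> i < j \<and> j < Suc n \<and> C i j) \<longleftrightarrow>
        (\<exists>i j. 1 \<le> i \<and> i < j \<and> j < n \<and> C i j) \<or> (\<exists>i. 1 \<le> i \<and> i < n \<and> C i n)"
      for C :: "nat \<Rightarrow> nat \<Rightarrow> bool"
      by (simp only: less_Suc_eq[of _ n] conj_disj_distribL conj_disj_distribR ex_disj_distrib) blast
    have "?S \<longleftrightarrow> (\<exists>i j. 1 \<le> i \<and> i < j \<and> j < n \<and> (?\<sigma> (Suc j) < ?\<sigma> i \<and> ?\<sigma> i < b \<and> b \<le> ?\<sigma> j)) \<or>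
        (\<exists>i. 1 \<le> i \<and> i < n \<and> a < ?\<sigma> i \<and> ?\<sigma> i < b \<and> b \<le> ?\<sigma> n)"
      using split_last[of "\<lambda>i j. ?\<sigma> (Suc j) < ?\<sigma> i \<and> ?\<sigma> i < b \<and> b \<le> ?\<sigma> j"]
      by (simp only: append_value_last)
    also have "(\<exists>i j. 1 \<le> i \<and> i < j \<and> j < n \<and> (?\<sigma> (Suc j) < ?\<sigma> i \<and> ?\<sigma> i < b \<and> b \<le> ?\<sigma> j)) \<longleftrightarrow> ?T"
      by (intro ex_cong1 conj_cong refl old)
    finally show ?thesis unfolding new .
  qed
  have "b \<in> active (Suc n) ?\<sigma> \<longleftrightarrow> ?b \<in> {1..Suc n} \<and>
      \<not> (\<exists>i j. 1 \<le> i \<and> i < j \<and> j < n \<and> \<pi> (Suc j) < \<pi> i \<and> \<pi> i < ?b \<and> ?b \<le> \<pi> j) \<and>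
      \<not> (Suc a < b \<and> b \<le> Suc (\<pi> n))"
    unfolding active_def mem_Collect_eq split rng by blast
  also have "\<dots> \<longleftrightarrow> ?b \<in> active n \<pi> \<and> (Suc a < b \<longrightarrow> Suc (\<pi> n) < b)"
    unfolding active_def mem_Collect_eq by auto
  finally show ?thesis .
qed

lemma low_label_append_value:
  assumes n: "n \<ge> 1" and p: "\<pi> permutes {1..n}" and a: "a \<in> active n \<pi>"
  shows "low_label (Suc n) (append_value n \<pi> a) = card {b \<in> active n \<pi>. b \<le> a}"
proof -
  have "a \<in> {1..Suc n}" using a active_subset by blast
  note mem = active_append_value[OF n p this]
  show ?thesis unfolding low_label_def append_value_last
    by (rule arg_cong[of _ _ card]) (auto simp: mem)
qed

lemma high_label_append_value:
  assumes n: "n \<ge> 1" and p: "\<pi> permutes {1..n}" and a: "a \<in> active n \<pi>"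
  shows "high_label (Suc n) (append_value n \<pi> a) =
     (if a \<le> \<pi> n then Suc (high_label n \<pi>) else card {b \<in> active n \<pi>. a \<le> b})"
proof -
  let ?H = "{b \<in> active n \<pi>. \<pi> n < b}" and ?S = "{b \<in> active (Suc n) (append_value n \<pi> a). a < b}"
  have "a \<in> {1..Suc n}" using a active_subset by blast
  note mem = active_append_value[OF n p this]
  show ?thesis
  proof (cases "a \<le> \<pi> n")
    case True
    have eq: "?S = insert (Suc a) (Suc ` ?H)"
    proof (intro set_eqI iffI)
      fix b assume b: "b \<in> ?S"
      then show "b \<in> insert (Suc a) (Suc ` ?H)"
        by (cases b) (auto simp: mem)
    next
      fix b assume "b \<in> insert (Suc a) (Suc ` ?H)"
      then show "b \<in> ?S" using True a by (auto simp: mem)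
    qed
    have "card ?S = Suc (card ?H)"
      unfolding eq using True finite_active[of n \<pi>]
      by (subst card_insert_disjoint) (auto simp: card_image)
    then show ?thesis using True by (simp add: high_label_def append_value_last)
  next
    case False
    have eq: "?S = Suc ` {b \<in> active n \<pi>. a \<le> b}"
    proof (intro set_eqI iffI)
      fix b assume b: "b \<in> ?S"
      then show "b \<in> Suc ` {b \<in> active n \<pi>. a \<le> b}"
        by (cases b) (auto simp: mem)
    next
      fix b assume "b \<in> Suc ` {b \<in> active n \<pi>. a \<le> b}"
      then show "b \<in> ?S" using False a by (auto simp: mem)
    qed
    then show ?thesis using False by (simp add: high_label_def append_value_last card_image)
  qed
qed

text \<open>
  Used to replace a sum over sites by a sum over labels: the low label of a child is the rank of the
  appended value among the active sites.
\<close>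

lemma sum_over_ranks:
  fixes A :: "'a::linorder set"
  assumes "finite A"
  shows "(\<Sum>a\<in>A. f (card {b \<in> A. b \<le> a})) = (\<Sum>i=1..card A. f i)"
  using assms
proof (induction A rule: finite_linorder_max_induct)
  case empty
  then show ?case by simp
next
  case (insert m A)
  have "m \<notin> A" using insert by auto
  have "{b \<in> insert m A. b \<le> m} = insert m A" using insert by auto
  moreover have "{b \<in> insert m A. b \<le> a} = {b \<in> A. b \<le> a}" if "a \<in> A" for a
    using that insert by auto
  ultimately show ?case
    using insert \<open>m \<notin> A\<close> by (simp add: add.commute)
qed

text \<open>
  The succession rule, in the form in which it is iterated. Appending a value not above the last
  entry is a descent and keeps all high sites plus one; appending a higher one duplicates its own
  site and merely divides the active sites in a new way.
\<close>

lemma sum_children: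
  fixes f :: "nat \<Rightarrow> nat \<Rightarrow> nat"
  assumes n: "n \<ge> 1" and p: "\<pi> permutes {1..n}"
  shows "(\<Sum>a\<in>active n \<pi>. f (low_label (Suc n) (append_value n \<pi> a)) (high_label (Suc n) (append_value n \<pi> a)))
     = (\<Sum>i=1..low_label n \<pi>. f i (Suc (high_label n \<pi>)))
       + (\<Sum>i=1..high_label n \<pi>. f (low_label n \<pi> + i) (Suc (high_label n \<pi>) - i))"
proof -
  let ?A = "active n \<pi>"
  let ?L = "{a \<in> ?A. a \<le> \<pi> n}" and ?H = "{a \<in> ?A. \<pi> n < a}"
  let ?g = "\<lambda>a. f (low_label (Suc n) (append_value n \<pi> a)) (high_label (Suc n) (append_value n \<pi> a))"
  have fin: "finite ?L" "finite ?H" using finite_active[of n \<pi>] by auto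
  have "sum ?g ?A = sum ?g (?L \<union> ?H)" by (rule sum.cong) auto
  also have "\<dots> = sum ?g ?L + sum ?g ?H" by (rule sum.union_disjoint) (use fin in auto)
  also have "sum ?g ?L = (\<Sum>a\<in>?L. f (card {b \<in> ?L. b \<le> a}) (Suc (high_label n \<pi>)))"
  proof (rule sum.cong[OF refl])
    fix a assume a: "a \<in> ?L"
    then have "{b \<in> ?A. b \<le> a} = {b \<in> ?L. b \<le> a}" by auto
    then show "?g a = f (card {b \<in> ?L. b \<le> a}) (Suc (high_label n \<pi>))"
      using a low_label_append_value[OF n p] high_label_append_value[OF n p] by simp
  qed
  also have "\<dots> = (\<Sum>i=1..low_label n \<pi>. f i (Suc (high_label n \<pi>)))"
    unfolding low_label_def by (rule sum_over_ranks[OF fin(1)])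
  also have "sum ?g ?H = (\<Sum>a\<in>?H. f (low_label n \<pi> + card {b \<in> ?H. b \<le> a})
      (Suc (high_label n \<pi>) - card {b \<in> ?H. b \<le> a}))"
  proof (rule sum.cong[OF refl])
    fix a assume a: "a \<in> ?H"
    \<comment> \<open>All low sites lie below a, so the rank of a among active sites exceeds its rank in ?H by the low label.\<close>
    have "{b \<in> ?A. b \<le> a} = ?L \<union> {b \<in> ?H. b \<le> a}" using a by auto
    then have 1: "card {b \<in> ?A. b \<le> a} = low_label n \<pi> + card {b \<in> ?H. b \<le> a}"
      unfolding low_label_def using fin by (simp add: card_Un_disjoint disjoint_iff)
    have eq: "insert a ?H = {b \<in> ?H. b \<le> a} \<union> {b \<in> ?A. a < b}" using a by auto
    have "card (insert a ?H) = card {b \<in> ?H. b \<le> a} + card {b \<in> ?A. a < b}"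
      unfolding eq by (rule card_Un_disjoint) (use fin finite_active[of n \<pi>] in auto)
    then have 2: "high_label n \<pi> = card {b \<in> ?H. b \<le> a} + card {b \<in> ?A. a < b}"
      using a by (simp add: high_label_def insert_absorb)
    have "{b \<in> ?A. a \<le> b} = insert a {b \<in> ?A. a < b}" using a by auto
    then have "card {b \<in> ?A. a \<le> b} = Suc (card {b \<in> ?A. a < b})"
      using finite_active[of n \<pi>] by simp
    then have 3: "card {b \<in> ?A. a \<le> b} = Suc (high_label n \<pi>) - card {b \<in> ?H. b \<le> a}"
      using 2 by simp
    show "?g a = f (low_label n \<pi> + card {b \<in> ?H. b \<le> a})
      (Suc (high_label n \<pi>) - card {b \<in> ?H. b \<le> a})"
      using a low_label_append_value[OF n p] high_label_append_value[OF n p] 1 3 by simp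
  qed
  also have "\<dots> = (\<Sum>i=1..high_label n \<pi>. f (low_label n \<pi> + i) (Suc (high_label n \<pi>) - i))"
    unfolding high_label_def
    using sum_over_ranks[OF fin(2), of "\<lambda>i. f (low_label n \<pi> + i) (Suc (card ?H) - i)"] by simp
  finally show ?thesis .
qed

lemma SB_add_eq_sum_tree_count:
  "n \<ge> 1 \<Longrightarrow> SB (n + m) = (\<Sum>\<pi> | semi_baxter n \<pi>. tree_count m (low_label n \<pi>) (high_label n \<pi>))"
proof (induction m arbitrary: n)
  case 0
  then show ?case by (simp add: SB_def)
next
  case (Suc m)
  let ?f = "\<lambda>\<sigma>. tree_count m (low_label (Suc n) \<sigma>) (high_label (Suc n) \<sigma>)"
  have "SB (n + Suc m) = (\<Sum>\<sigma> | semi_baxter (Suc n) \<sigma>. ?f \<sigma>)"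
    using Suc.IH[of "Suc n"] by simp
  also have "\<dots> = (\<Sum>(\<pi>, a)\<in>(SIGMA \<pi>:{\<pi>. semi_baxter n \<pi>}. active n \<pi>). ?f (append_value n \<pi> a))"
    by (subst sum.reindex_bij_betw[OF bij_betw_append_value, symmetric]) (simp add: case_prod_unfold)
  also have "\<dots> = (\<Sum>\<pi> | semi_baxter n \<pi>. \<Sum>a\<in>active n \<pi>. ?f (append_value n \<pi> a))"
    by (rule sum.Sigma[symmetric]) (use finite_semi_baxter finite_active in auto)
  also have "\<dots> = (\<Sum>\<pi> | semi_baxter n \<pi>. tree_count (Suc m) (low_label n \<pi>) (high_label n \<pi>))"
    by (rule sum.cong[OF refl])
      (use sum_children[OF Suc.prems, of _ "tree_count m"] in \<open>auto simp: semi_baxter_def\<close>)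
  finally show ?case .
qed

theorem SB_eq_tree_count: "SB (Suc m) = tree_count m 1 1"
proof -
  have "semi_baxter 1 \<pi> \<longleftrightarrow> \<pi> = id" for \<pi>
    by (auto simp: semi_baxter_def permutes_sing)
  moreover have "active 1 id = {1, 2}" by (auto simp: active_def)
  then have "{a \<in> active 1 id. a \<le> id 1} = {1}" "{a \<in> active 1 id. id 1 < a} = {2}" by auto
  then have "low_label 1 id = 1" "high_label 1 id = 1"
    unfolding low_label_def high_label_def by simp_all
  ultimately show ?thesis using SB_add_eq_sum_tree_count[of 1 m] by simp
qed

section \<open>The succession rule and the kernel\<close>

text \<open>
  The children of the label \<open>(Suc a, Suc b)\<close>; all labels are positive, so both exponents are
  lowered by one.
\<close>

definition children :: "nat \<Rightarrow> nat \<Rightarrow> 'a::field \<Rightarrow> 'a \<Rightarrow> 'a" where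
  "children a b y z =
     (\<Sum>i<Suc a. y ^ i * z ^ Suc b) + (\<Sum>i<Suc b. y ^ (Suc a + i) * z ^ (b - i))"

definition step_weight :: "'a::field \<Rightarrow> 'a \<Rightarrow> 'a" where
  "step_weight y z = y * z * (z - 1) / ((y - 1) * (z - y))"

text \<open>
  With \<open>y = 1 + u\<close> and \<open>z = y + v\<close>, the five points arise from \<open>(y, z)\<close> by applying
  alternately the two involutions that preserve \<open>step_weight\<close>, beginning with \<open>(y, z)\<close> to
  \<open>(z / y, z)\<close>. Once the first coefficient has been chosen as \<open>v\<close>, the others are forced by
  the cancellations in \<open>orbit_sum_children\<close>.
\<close>

definition orbit_sum :: "'a::field \<Rightarrow> 'a \<Rightarrow> ('a \<Rightarrow> 'a \<Rightarrow> 'a) \<Rightarrow> 'a" where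
  "orbit_sum u v F =
     (let y = 1 + u; z = 1 + u + v; c = u + v in
        v * F y z
      - v ^ 2 / (u * y) * F (z / y) z
      + v ^ 3 / (u ^ 3 * y * z) * F (z / y) (c / u)
      - v ^ 3 / (u ^ 4 * z ^ 2) * F (c * y / (u * z)) (c / u)
      + v ^ 2 * y / (u ^ 4 * z ^ 2 * c) * F (c * y / (u * z)) (y / u))"

lemma tree_count_Suc:
  "tree_count (Suc m) (Suc a) (Suc b) =
     (\<Sum>i<Suc a. tree_count m (Suc i) (Suc (Suc b)))
     + (\<Sum>i<Suc b. tree_count m (Suc (Suc a + i)) (Suc (b - i)))"
proof -
  have 1: "(\<Sum>i=1..Suc a. f i) = (\<Sum>i<Suc a. f (Suc i))" for f :: "nat \<Rightarrow> nat" and a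
    by (metis One_nat_def sum.shift_bounds_Suc_ivl atLeastLessThanSuc_atLeastAtMost lessThan_atLeast0)
  show ?thesis
    unfolding tree_count.simps 1
    by (intro arg_cong2[of _ _ _ _ "(+)"] sum.cong refl) (auto simp: Suc_diff_le)
qed

text \<open>
  Both families of children are geometric sums, and
  \<open>step_weight y z = y z / (y - 1) + y z / (z - y)\<close>.
\<close>

lemma children_eq:
  assumes "y \<noteq> 1" "z \<noteq> y"
  shows "children a b y z =
     step_weight y z * (y ^ a * z ^ b) - z ^ Suc b / (y - 1) - y ^ (a + b + 2) / (z - y)"
proof -
  have nz: "y - 1 \<noteq> 0" "z - y \<noteq> 0" using assms by auto
  have 1: "(\<Sum>i<Suc a. y ^ i * z ^ Suc b) = z ^ Suc b * (y ^ Suc a - 1) / (y - 1)"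
    unfolding sum_distrib_right[symmetric] geometric_sum[OF assms(1)] by simp
  have "z ^ Suc b - y ^ Suc b = (z - y) * (\<Sum>i<Suc b. y ^ i * z ^ (b - i))"
    using diff_power_eq_sum[of y b z] by (simp add: algebra_simps del: sum.lessThan_Suc)
  then have "(\<Sum>i<Suc b. y ^ i * z ^ (b - i)) = (z ^ Suc b - y ^ Suc b) / (z - y)"
    using nz by (simp add: field_simps del: sum.lessThan_Suc)
  then have 2: "(\<Sum>i<Suc b. y ^ (Suc a + i) * z ^ (b - i)) = y ^ Suc a * ((z ^ Suc b - y ^ Suc b) / (z - y))"
    by (simp only: power_add mult.assoc sum_distrib_left[symmetric])
  have 3: "step_weight y z = y * z / (y - 1) + y * z / (z - y)"
    using nz by (simp add: step_weight_def field_simps)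
  show ?thesis
    unfolding children_def 1 2 3
    by (simp add: diff_divide_distrib distrib_right right_diff_distrib distrib_left power_add power2_eq_square ac_simps)
qed

lemma orbit_sum_sum: "orbit_sum u v (\<lambda>y z. \<Sum>i\<in>A. F i y z) = (\<Sum>i\<in>A. orbit_sum u v (F i))"
  by (simp add: orbit_sum_def Let_def sum_distrib_left sum.distrib sum_subtractf)

lemma orbit_sum_add: "orbit_sum u v (\<lambda>y z. F y z + G y z) = orbit_sum u v F + orbit_sum u v G"
  by (simp only: orbit_sum_def Let_def distrib_left diff_conv_add_uminus minus_add_distrib add_ac)

text \<open>
  The boundary term \<open>z^(b+1) / (y - 1)\<close> is matched between two points with the same second
  coordinate, and \<open>y^(a+b+2) / (z - y)\<close> between two points with the same first coordinate.
  Consecutive points of the orbit have one of the two in common in turn, so all boundary terms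
  but the outermost two cancel.
\<close>

lemma orbit_sum_children:
  fixes u v :: "'a::field"
  assumes nz: "u \<noteq> 0" "v \<noteq> 0" "1 + u \<noteq> 0" "1 + u + v \<noteq> 0" "u + v \<noteq> 0"
  shows "orbit_sum u v (children a b) =
     step_weight (1 + u) (1 + u + v) * orbit_sum u v (\<lambda>y z. y ^ a * z ^ b)
     - (1 + u) ^ (a + b + 2)
     - (1 + u) ^ 2 / (step_weight (1 + u) (1 + u + v) * u ^ 4) * ((1 + u) / u) ^ Suc b"
proof -
  define y z c where yzc: "y = 1 + u" "z = 1 + u + v" "c = u + v"
  have fold: "1 + u = y" "y + v = z" "u + v = c" by (simp_all add: yzc)
  define W where "W = y * z * c / (u * v)"
  have y: "y \<noteq> 0" and z: "z \<noteq> 0" and c: "c \<noteq> 0" using nz yzc by auto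
  note nz' = nz(1,2) y z c
  have W: "W = step_weight y z" by (simp add: W_def step_weight_def yzc)
  define t1 where "t1 = v ^ 2 / (u * y)"
  define t2 where "t2 = v ^ 3 / (u ^ 3 * y * z)"
  define t3 where "t3 = v ^ 3 / (u ^ 4 * z ^ 2)"
  define t4 where "t4 = v ^ 2 * y / (u ^ 4 * z ^ 2 * c)"
  note t = t1_def t2_def t3_def t4_def
  \<comment> \<open>The numbers y - 1 and z - y at the five points; all of them are monomials in u, v, y, z, c.\<close>
  have d0: "y - 1 = u" "z - y = v" by (simp_all add: yzc)
  have d1: "z / y - 1 = v / y" "z - z / y = z * u / y"
    using nz' by (auto simp: field_simps yzc)
  have d2: "c / u - z / y = v / (y * u)" using nz' by (simp add: field_simps) (simp add: yzc algebra_simps)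
  have d3: "c * y / (u * z) - 1 = v / (u * z)" "c / u - c * y / (u * z) = c * v / (u * z)"
    using nz' by (simp_all add: field_simps) (simp_all add: yzc algebra_simps)
  have d4: "y / u - c * y / (u * z) = y / (u * z)"
    using nz' by (simp add: field_simps) (simp add: yzc algebra_simps)
  have z1: "z - 1 = c" "c / u - 1 = v / u" "y / u - 1 = 1 / u"
    using nz' by (auto simp: field_simps yzc)
  have W1: "step_weight (z / y) z = W" unfolding step_weight_def d1 z1 using nz' by (simp add: W_def field_simps)
  have W2: "step_weight (z / y) (c / u) = W" unfolding step_weight_def d1 d2 z1 using nz' by (simp add: W_def field_simps)
  have W3: "step_weight (c * y / (u * z)) (c / u) = W"
    unfolding step_weight_def d3 z1 using nz' by (simp add: W_def field_simps)
  have W4: "step_weight (c * y / (u * z)) (y / u) = W"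
    unfolding step_weight_def d3 d4 z1 using nz' by (simp add: W_def field_simps)
  have C: "children a b s t = step_weight s t * (s ^ a * t ^ b) - t ^ Suc b / (s - 1) - s ^ (a + b + 2) / (t - s)"
    if "s - 1 \<noteq> 0" "t - s \<noteq> 0" for s t :: 'a
    using children_eq[of s t a b] that by auto
  have C0: "children a b y z = W * (y ^ a * z ^ b) - z ^ Suc b / u - y ^ (a + b + 2) / v"
    using C[of y z] nz' unfolding d0 W by auto
  have C1: "children a b (z / y) z = W * ((z / y) ^ a * z ^ b) - z ^ Suc b / (v / y)
      - (z / y) ^ (a + b + 2) / (z * u / y)"
    using C[of "z / y" z] nz' unfolding d1 W1 by auto
  have C2: "children a b (z / y) (c / u) = W * ((z / y) ^ a * (c / u) ^ b) - (c / u) ^ Suc b / (v / y)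
      - (z / y) ^ (a + b + 2) / (v / (y * u))"
    using C[of "z / y" "c / u"] nz' unfolding d1 d2 W2 by auto
  have C3: "children a b (c * y / (u * z)) (c / u) = W * ((c * y / (u * z)) ^ a * (c / u) ^ b)
      - (c / u) ^ Suc b / (v / (u * z)) - (c * y / (u * z)) ^ (a + b + 2) / (c * v / (u * z))"
    using C[of "c * y / (u * z)" "c / u"] nz' unfolding d3 W3 by auto
  have C4: "children a b (c * y / (u * z)) (y / u) = W * ((c * y / (u * z)) ^ a * (y / u) ^ b)
      - (y / u) ^ Suc b / (v / (u * z)) - (c * y / (u * z)) ^ (a + b + 2) / (y / (u * z))"
    using C[of "c * y / (u * z)" "y / u"] nz' unfolding d3 d4 W4 by auto
  \<comment> \<open>The first and the last identity treat the two ends of the chain, the others the four cancellations.\<close>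
  have e: "v * (A / v) = A" "v * (A / u) = t1 * (A / (v / y))"
    "t1 * (A / (z * u / y)) = t2 * (A / (v / (y * u)))"
    "t2 * (A / (v / y)) = t3 * (A / (v / (u * z)))"
    "t3 * (A / (c * v / (u * z))) = t4 * (A / (y / (u * z)))"
    "t4 * (A / (v / (u * z))) = y ^ 2 / (W * u ^ 4) * A" for A
    using nz' by (simp_all add: t W_def field_simps power2_eq_square power3_eq_cube power4_eq_xxxx)
  show ?thesis
    unfolding orbit_sum_def Let_def fold W[symmetric] t[symmetric] C0 C1 C2 C3 C4
      right_diff_distrib distrib_left e
    by (simp add: ac_simps)
qed

text \<open>
  After multiplication by the step weight, each of the five terms is a monomial in \<open>u, v, y, z\<close> and \<open>c = u + v\<close>. Only the last two have
  \<open>z\<close> in the denominator, and their numerators combine to \<open>y - c v = z (1 - v)\<close>, so the result is a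
  polynomial in \<open>v\<close>.
\<close>

lemma orbit_sum_one:
  fixes u v :: "'a::field"
  assumes nz: "u \<noteq> 0" "v \<noteq> 0" "1 + u \<noteq> 0" "1 + u + v \<noteq> 0" "u + v \<noteq> 0"
  shows "step_weight (1 + u) (1 + u + v) * orbit_sum u v (\<lambda>y z. 1) =
     (1 + u) ^ 2
     + (1 + u) * (1 / u ^ 5 + 2) * v
     + (- (1 + u) / u ^ 5 + 1 / u ^ 3 - (1 + u) / u ^ 2 + 1) * v ^ 2
     + (1 / u ^ 4 - 1 / u ^ 2) * v ^ 3"
proof -
  define y z c where yzc: "y = 1 + u" "z = 1 + u + v" "c = u + v"
  have fold: "1 + u = y" "y + v = z" "u + v = c" by (simp_all add: yzc)
  have y: "y \<noteq> 0" and z: "z \<noteq> 0" and c: "c \<noteq> 0" using nz yzc by auto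
  note nz' = nz(1,2) y z c
  have W: "step_weight y z = y * z * c / (u * v)" by (simp add: step_weight_def yzc)
  have t: "step_weight y z * v = z * c * (y / u)"
    "step_weight y z * (v ^ 2 / (u * y)) = z * c * (v / u ^ 2)"
    "step_weight y z * (v ^ 3 / (u ^ 3 * y * z)) = c * v ^ 2 / u ^ 4"
    "step_weight y z * (v ^ 3 / (u ^ 4 * z ^ 2)) = y * v / u ^ 5 * (c * v / z)"
    "step_weight y z * (v ^ 2 * y / (u ^ 4 * z ^ 2 * c)) = y * v / u ^ 5 * (y / z)"
    using nz' by (simp_all add: W field_simps power_numeral_reduce)
  have q: "y / z - c * v / z = 1 - v"
    using z by (simp add: field_simps) (simp add: yzc algebra_simps)
  have zc: "z * c = y * u + (1 + 2 * u) * v + v ^ 2" by (simp add: yzc algebra_simps power2_eq_square)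
  have "step_weight y z * orbit_sum u v (\<lambda>y z. 1) =
      z * c * (y / u) - z * c * (v / u ^ 2) + c * v ^ 2 / u ^ 4 + y * v / u ^ 5 * (y / z - c * v / z)"
    unfolding orbit_sum_def Let_def fold mult_1_right
    by (simp only: right_diff_distrib distrib_left t) (simp only: algebra_simps)
  also have "\<dots> = y ^ 2 + y * (1 / u ^ 5 + 2) * v
      + (- y / u ^ 5 + 1 / u ^ 3 - y / u ^ 2 + 1) * v ^ 2 + (1 / u ^ 4 - 1 / u ^ 2) * v ^ 3"
    using nz(1) unfolding q zc
    by (simp add: yzc(1,3) field_simps power_numeral_reduce)
  finally show ?thesis unfolding yzc .
qed

section \<open>Counting tree nodes by residues\<close>

notation fls_nth (infixl "$$" 75)

abbreviation inner_X :: "real fls" where "inner_X \<equiv> fls_X"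

text \<open>
  The two variables as elements of the field of Laurent series in \<open>v\<close> over the field of Laurent
  series in \<open>u\<close>. In this field all denominators that occur are invertible.
\<close>

definition bi_u :: "real fls fls" where "bi_u = fls_const fls_X"
definition bi_v :: "real fls fls" where "bi_v = fls_X"

definition W :: "real fls fls" where
  "W = step_weight (1 + bi_u) (1 + bi_u + bi_v)"

definition residue2 :: "real fls fls \<Rightarrow> real" where
  "residue2 f = (f $$ (-1)) $$ (-1)"

lemma residue2_add: "residue2 (f + g) = residue2 f + residue2 g"
  and residue2_sum: "residue2 (\<Sum>i\<in>A. h i) = (\<Sum>i\<in>A. residue2 (h i))"
  by (simp_all add: residue2_def fls_nth_sum)

lemmas fls_const_hom = fls_const_mult_const fls_const_divide_const fls_plus_const fls_minus_const fls_const_power[symmetric]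

lemma fls_X_inv_eq: "(fls_X_inv :: 'a::field fls) = inverse fls_X"
  by (rule sym, rule inverse_unique) (simp add: fls_X_times_conv_shift)

lemma one_plus_X_nonzero: "1 + inner_X \<noteq> 0"
proof
  assume "1 + inner_X = 0"
  then have "(1 + inner_X) $$ 0 = 0" by simp
  then show False by simp
qed

lemma bi_y_eq: "1 + bi_u = fls_const (1 + inner_X)"
  by (simp add: bi_u_def flip: fls_plus_const)

lemma bi_nonzero:
  "bi_u \<noteq> 0" "bi_v \<noteq> 0" "1 + bi_u \<noteq> 0" "1 + bi_u + bi_v \<noteq> 0" "bi_u + bi_v \<noteq> 0"
proof -
  show "bi_u \<noteq> 0" "bi_v \<noteq> 0" by (simp_all add: bi_u_def bi_v_def)
  show "1 + bi_u \<noteq> 0" using one_plus_X_nonzero by (simp add: bi_y_eq)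
  have "(1 + bi_u + bi_v) $$ 1 = 1" "(bi_u + bi_v) $$ 1 = 1" by (simp_all add: bi_u_def bi_v_def)
  then show "1 + bi_u + bi_v \<noteq> 0" "bi_u + bi_v \<noteq> 0"
    by (metis fls_zero_nth zero_neq_one)+
qed

lemma W_eq_product:
  "W = (1 + bi_u) * (1 + bi_u + bi_v) * (bi_u + bi_v) / (bi_u * bi_v)"
  by (simp add: W_def step_weight_def)

lemma W_nonzero: "W \<noteq> 0"
  using bi_nonzero by (simp add: W_eq_product)

text \<open>
  In this form the dependence on \<open>v\<close> is explicit: \<open>W = (y / u) (v + 1 + 2 u + u y / v)\<close>.
\<close>

lemma W_expand:
  "W = fls_const ((1 + inner_X) / inner_X) *
     (fls_X + fls_const (1 + 2 * inner_X) + fls_const (inner_X * (1 + inner_X)) * fls_X_inv)"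
proof -
  have inv: "fls_X_inv = 1 / bi_v" by (simp only: bi_v_def fls_X_inv_eq inverse_eq_divide)
  have c1: "fls_const ((1 + inner_X) / inner_X) = (1 + bi_u) / bi_u"
    unfolding bi_y_eq by (simp only: bi_u_def fls_const_divide_const)
  have c2: "fls_const (1 + 2 * inner_X) = 1 + 2 * bi_u"
    by (simp add: bi_u_def flip: fls_plus_const fls_const_mult_const)
  have c3: "fls_const (inner_X * (1 + inner_X)) = bi_u * (1 + bi_u)"
    unfolding bi_y_eq by (simp only: bi_u_def fls_const_mult_const)
  show ?thesis
    unfolding W_eq_product inv c1 c2 c3 bi_v_def[symmetric]
    using bi_nonzero(1,2) by (simp add: field_simps)
qed

lemma deriv_W:
  "fls_deriv W = fls_const ((1 + inner_X) / inner_X) * (1 - fls_const (inner_X * (1 + inner_X)) * fls_X_inv ^ 2)"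
  unfolding W_expand by (simp del: fls_const_mult_const)

lemma subdegree_W: "fls_subdegree W = -1"
proof (rule fls_subdegree_eqI)
  have "(1 + x) / x * (x * (1 + x)) \<noteq> 0" if "x \<noteq> 0" "1 + x \<noteq> 0" for x :: "real fls"
    using that by simp
  from this[OF _ one_plus_X_nonzero]
  have "(1 + inner_X) / inner_X * (inner_X * (1 + inner_X)) \<noteq> 0" by (simp only: fls_X_nonzero not_False_eq_True)
  moreover have "(fls_X + fls_const (1 + 2 * inner_X) + fls_const (inner_X * (1 + inner_X)) * fls_X_inv) $$ (-1)
      = inner_X * (1 + inner_X)"
    by simp
  ultimately show "W $$ (-1) \<noteq> 0" by (simp only: W_expand fls_mult_const_nth not_False_eq_True)
qed (simp add: W_expand)

text \<open>
  The expression is the derivative with respect to \<open>v\<close> of a multiple of \<open>W^(m+1)\<close>.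
\<close>

lemma residue_dW_power: "(fls_deriv W * W ^ m * fls_const k) $$ (-1) = 0"
proof -
  have "fls_deriv (W ^ Suc m * fls_const k) = of_nat (Suc m) * (fls_deriv W * W ^ m * fls_const k)"
    unfolding fls_deriv_mult fls_deriv_power by (simp add: ac_simps del: of_nat_Suc power_Suc)
  then have "of_nat (Suc m) * (fls_deriv W * W ^ m * fls_const k) $$ (-1) = 0"
    by (metis fls_deriv_residue fls_mult_const_nth(1) fls_of_nat)
  then show ?thesis by (simp del: of_nat_Suc)
qed

text \<open>
  The residue of a logarithmic derivative is the order at zero, and \<open>W\<close> has a simple pole in \<open>v\<close>.
\<close>

lemma residue_dlog_W: "(fls_deriv W / W * fls_const k) $$ (-1) = - k"
  using fls_residue_deriv_times_inverse_eq_subdegree(1)[of W]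
  by (simp add: subdegree_W divide_inverse)

lemma one_plus_X_power_div_nth:
  "((1 + inner_X) ^ p / inner_X ^ q) $$ (-1) = (if q = 0 then 0 else real (p choose (q - 1)))"
proof -
  have "inverse (inner_X ^ q) = fls_X_inv ^ q"
    by (simp only: fls_X_inv_eq power_inverse)
  then have "(1 + inner_X) ^ p / inner_X ^ q = (\<Sum>k\<le>p. fls_const (real (p choose k)) * fls_X ^ k) * fls_X_inv ^ q"
    by (simp add: binomial_ring[of fls_X 1] add.commute[of 1] divide_inverse fls_of_nat)
  also have "\<dots> $$ (-1) = (\<Sum>k\<le>p. if int k = int q - 1 then real (p choose k) else 0)"
    by (auto simp: fls_X_inv_power_times_conv_shift fls_nth_sum intro!: sum.cong)
  also have "\<dots> = (if q = 0 then 0 else real (p choose (q - 1)))"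
  proof (cases q)
    case (Suc r)
    have "(\<Sum>k\<le>p. if int k = int q - 1 then real (p choose k) else 0)
        = (\<Sum>k\<le>p. if k = r then real (p choose k) else 0)"
      using Suc by (intro sum.cong) auto
    also have "\<dots> = real (p choose r)" by (auto simp: sum.delta')
    finally show ?thesis using Suc by simp
  qed auto
  finally show ?thesis .
qed

definition regular :: "'a::zero fls \<Rightarrow> bool" where
  "regular f \<longleftrightarrow> (\<forall>n<0. f $$ n = 0)"

lemma regular_iff: "regular f \<longleftrightarrow> fls_subdegree f \<ge> 0"
  unfolding regular_def using fls_subdegree_ge0I by (metis fls_eq0_below_subdegree order_less_le_trans)

lemma regular_add: "regular f \<Longrightarrow> regular g \<Longrightarrow> regular (f + g)"
  and regular_diff: "regular f' \<Longrightarrow> regular g' \<Longrightarrow> regular (f' - g')"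
  by (simp_all add: regular_def)

lemma regular_const: "regular (fls_const k)" by (simp add: regular_def)

lemma regular_mult: "regular f \<Longrightarrow> regular g \<Longrightarrow> regular (f * g)"
  for f g :: "'a::field fls"
  unfolding regular_iff by (cases "f = 0 \<or> g = 0") auto

lemma regular_one: "regular (1 :: 'a::field fls)"
  by (simp add: regular_def)

lemma regular_power: "regular f \<Longrightarrow> regular (f ^ n)"
  for f :: "'a::field fls"
  by (induction n) (auto intro: regular_mult regular_one)

lemma regular_divide: "regular f \<Longrightarrow> fls_subdegree g = 0 \<Longrightarrow> regular (f / g)"
  for f g :: "'a::field fls"
  unfolding divide_inverse by (rule regular_mult) (simp_all add: regular_iff)

lemma regular_sum: "(\<And>i. i \<in> A \<Longrightarrow> regular (f i)) \<Longrightarrow> regular (sum f A)"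
  for f :: "'b \<Rightarrow> 'a::field fls"
  by (simp add: regular_def fls_nth_sum)

text \<open>
  Only the first of the five points contributes to lowest order in \<open>v\<close>: the coefficients of the
  others are divisible by \<open>v^2\<close>, and at \<open>v = 0\<close> none of their coordinates has a pole.
\<close>

lemma orbit_sum_leading:
  obtains r where "regular r"
    "orbit_sum bi_u bi_v (\<lambda>y z. y ^ a * z ^ b) = fls_const ((1 + inner_X) ^ (a + b)) * bi_v + bi_v ^ 2 * r"
proof -
  define y z c where yzc: "y = 1 + bi_u" "z = 1 + bi_u + bi_v" "c = bi_u + bi_v"
  have fold: "1 + bi_u = y" "y + bi_v = z" "bi_u + bi_v = c" by (simp_all add: yzc)
  have nz: "bi_u \<noteq> 0" "y \<noteq> 0" "z \<noteq> 0" "c \<noteq> 0" using bi_nonzero by (simp_all add: yzc)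
  have sub: "fls_subdegree bi_u = 0" "fls_subdegree y = 0" "fls_subdegree z = 0" "fls_subdegree c = 0"
  proof -
    show "fls_subdegree bi_u = 0" by (simp add: bi_u_def)
    show "fls_subdegree y = 0" by (simp add: yzc bi_y_eq)
    show "fls_subdegree z = 0"
      by (rule fls_subdegree_eqI) (use one_plus_X_nonzero in \<open>auto simp: yzc bi_y_eq bi_v_def\<close>)
    show "fls_subdegree c = 0"
      by (rule fls_subdegree_eqI) (auto simp: yzc bi_u_def bi_v_def)
  qed
  have reg: "regular bi_u" "regular bi_v" "regular y" "regular z" "regular c"
    using sub by (simp_all add: regular_iff bi_v_def)
  note reg = reg regular_add regular_diff regular_mult regular_power regular_divide regular_one regular_sum
  note sub = sub nz fls_subdegree_pow
  obtain r0 where r0: "regular r0" "z ^ b = y ^ b + bi_v * r0"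
  proof (cases b)
    case 0
    then show ?thesis using that[of 0] by (simp add: regular_def)
  next
    case (Suc d)
    have "z ^ b - y ^ b = bi_v * (\<Sum>p<Suc d. z ^ p * y ^ (d - p))"
      unfolding Suc diff_power_eq_sum by (simp add: yzc del: sum.lessThan_Suc)
    then show ?thesis
      using that[of "\<Sum>p<Suc d. z ^ p * y ^ (d - p)"] by (simp add: reg algebra_simps del: sum.lessThan_Suc)
  qed
  define r where "r = y ^ a * r0
      - 1 / (bi_u * y) * ((z / y) ^ a * z ^ b)
      + bi_v / (bi_u ^ 3 * y * z) * ((z / y) ^ a * (c / bi_u) ^ b)
      - bi_v / (bi_u ^ 4 * z ^ 2) * ((c * y / (bi_u * z)) ^ a * (c / bi_u) ^ b)
      + y / (bi_u ^ 4 * z ^ 2 * c) * ((c * y / (bi_u * z)) ^ a * (y / bi_u) ^ b)"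
  have den: "fls_subdegree (bi_u * y) = 0" "fls_subdegree (bi_u ^ 3 * y * z) = 0"
    "fls_subdegree (bi_u ^ 4 * z ^ 2) = 0" "fls_subdegree (bi_u ^ 4 * z ^ 2 * c) = 0" "fls_subdegree (bi_u * z) = 0"
    by (simp_all add: sub)
  have "regular r" unfolding r_def by (intro reg r0 sub den)
  moreover have "orbit_sum bi_u bi_v (\<lambda>y z. y ^ a * z ^ b) = y ^ a * y ^ b * bi_v + bi_v ^ 2 * r"
    unfolding orbit_sum_def Let_def fold r_def r0(2)[symmetric]
    unfolding r0(2) by (simp add: algebra_simps power2_eq_square power3_eq_cube)
  ultimately show thesis
    using that by (simp add: power_add[symmetric] yzc(1) bi_y_eq flip: fls_const_power)
qed

text \<open>
  Since the derivative of \<open>W\<close> has a double pole in \<open>v\<close>, the residue in \<open>v\<close> only sees the leading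
  term of the orbit sum. That residue is \<open>(1 + u)^(a+b+2) / u\<close>, with residue 1.
\<close>

lemma residue2_initial:
  "residue2 (- fls_deriv W / bi_u * orbit_sum bi_u bi_v (\<lambda>y z. y ^ a * z ^ b)) = 1"
proof -
  define x where "x = inner_X"
  have x: "x \<noteq> 0" "1 + x \<noteq> 0" using one_plus_X_nonzero by (simp_all add: x_def)
  define A where "A = (1 + x) / x ^ 2"
  define B where "B = x * (1 + x)"
  define k where "k = (1 + x) ^ (a + b)"
  obtain r where r: "regular r"
    "orbit_sum bi_u bi_v (\<lambda>y z. y ^ a * z ^ b) = fls_const k * bi_v + bi_v ^ 2 * r"
    using orbit_sum_leading unfolding k_def x_def by blast
  have inv: "fls_X_inv * bi_v = 1"
    by (simp add: bi_v_def fls_X_inv_times_conv_shift)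
  have A: "fls_const A = fls_const ((1 + x) / x) / bi_u"
    by (simp add: bi_u_def x_def[symmetric] A_def fls_const_divide_const power2_eq_square)
  have kernel: "- fls_deriv W / bi_u = fls_const A * (fls_const B * fls_X_inv ^ 2 - 1)"
    unfolding A deriv_W x_def[symmetric] B_def[symmetric] by (simp add: diff_divide_distrib right_diff_distrib)
  have "- fls_deriv W / bi_u * orbit_sum bi_u bi_v (\<lambda>y z. y ^ a * z ^ b) =
      fls_const (A * k) * (fls_const B * (fls_X_inv * (fls_X_inv * bi_v)) - bi_v)
      + fls_const A * (fls_const B * (fls_X_inv * bi_v) ^ 2 - bi_v ^ 2) * r"
    unfolding r(2) kernel by (simp add: algebra_simps power2_eq_square flip: fls_const_mult_const)
  also have "\<dots> = fls_const (A * k) * (fls_const B * fls_X_inv - bi_v)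
      + fls_const A * (fls_const B - bi_v ^ 2) * r" (is "_ = ?main + ?rest")
    by (simp add: inv)
  also have "(?main + ?rest) $$ (-1) = A * k * B"
  proof -
    have "regular ?rest"
      by (intro regular_mult regular_diff regular_const regular_power r) (simp add: regular_def bi_v_def)
    then have "?rest $$ (-1) = 0" by (simp add: regular_def)
    moreover have "?main $$ (-1) = A * k * B" by (simp add: bi_v_def)
    ultimately show ?thesis by simp
  qed
  also have "A * k * B = (1 + x) ^ (a + b + 2) / x ^ 1"
    using x by (simp add: A_def B_def k_def field_simps power2_eq_square)
  finally show ?thesis
    unfolding residue2_def x_def by (simp only: one_plus_X_power_div_nth) simp
qed

text \<open>
  Of the terms in \<open>orbit_sum_children\<close> only the main one survives the residue.
\<close>

lemma residue2_step:
  "residue2 (- fls_deriv W / bi_u * W ^ m * orbit_sum bi_u bi_v (children a b)) =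
   residue2 (- fls_deriv W / bi_u * W ^ Suc m * orbit_sum bi_u bi_v (\<lambda>y z. y ^ a * z ^ b))"
proof -
  define x where "x = inner_X"
  have x: "x \<noteq> 0" using one_plus_X_nonzero by (simp_all add: x_def)
  define k where "k = (1 + x) ^ (a + b + 2) / x"
  define l where "l = (1 + x) ^ (b + 3) / x ^ (b + 6)"
  have k: "fls_const k = (1 + bi_u) ^ (a + b + 2) / bi_u"
    unfolding bi_y_eq by (simp only: bi_u_def fls_const_hom k_def x_def)
  have "l = (1 + x) ^ 2 / x ^ 5 * ((1 + x) / x) ^ Suc b"
    by (simp add: l_def power_divide power_add eval_nat_numeral mult.assoc)
  then have l: "fls_const l = (1 + bi_u) ^ 2 / bi_u ^ 5 * ((1 + bi_u) / bi_u) ^ Suc b"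
    unfolding bi_y_eq by (simp only: bi_u_def fls_const_hom x_def)
  have "- fls_deriv W / bi_u * W ^ m * orbit_sum bi_u bi_v (children a b) =
      - fls_deriv W / bi_u * W ^ Suc m * orbit_sum bi_u bi_v (\<lambda>y z. y ^ a * z ^ b)
      + fls_deriv W * W ^ m * fls_const k + fls_deriv W * W ^ m / W * fls_const l"
    unfolding orbit_sum_children[OF bi_nonzero] W_def[symmetric] k l
    using bi_nonzero(1) W_nonzero by (simp add: field_simps eval_nat_numeral)
  \<comment> \<open>For m = 0 the residue in v is - l, and l has numerator of degree b + 3, too small for a term of exponent -1.\<close>
  moreover have "(fls_deriv W * W ^ m / W * fls_const l) $$ (-1) $$ (-1) = 0"
  proof (cases m)
    case 0
    then have "(fls_deriv W * W ^ m / W * fls_const l) $$ (-1) = - l"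
      using residue_dlog_W by simp
    then have "(fls_deriv W * W ^ m / W * fls_const l) $$ (-1) $$ (-1) = - (l $$ (-1))"
      by (simp only: fls_uminus_nth)
    also have "l $$ (-1) = 0"
      unfolding l_def x_def one_plus_X_power_div_nth by (simp add: binomial_eq_0)
    finally show ?thesis by simp
  next
    case (Suc d)
    then have "fls_deriv W * W ^ m / W * fls_const l = fls_deriv W * W ^ d * fls_const l"
      using W_nonzero by simp
    then show ?thesis by (simp only: residue_dW_power fls_zero_nth)
  qed
  ultimately show ?thesis
    by (simp only: residue2_def fls_plus_nth residue_dW_power fls_zero_nth add_0_right)
qed

theorem tree_count_eq_residue:
  "real (tree_count m (Suc a) (Suc b)) =
     residue2 (- fls_deriv W / bi_u * W ^ m * orbit_sum bi_u bi_v (\<lambda>y z. y ^ a * z ^ b))"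
proof (induction m arbitrary: a b)
  case 0
  show ?case using residue2_initial by simp
next
  case (Suc m)
  let ?E = "\<lambda>F. residue2 (- fls_deriv W / bi_u * W ^ m * orbit_sum bi_u bi_v F)"
  have "real (tree_count (Suc m) (Suc a) (Suc b)) =
      (\<Sum>i<Suc a. ?E (\<lambda>y z. y ^ i * z ^ Suc b)) + (\<Sum>i<Suc b. ?E (\<lambda>y z. y ^ (Suc a + i) * z ^ (b - i)))"
    unfolding tree_count_Suc of_nat_add of_nat_sum Suc.IH ..
  also have "\<dots> = ?E (children a b)"
    unfolding children_def[abs_def] orbit_sum_add orbit_sum_sum distrib_left sum_distrib_left residue2_add residue2_sum ..
  also have "\<dots> = residue2 (- fls_deriv W / bi_u * W ^ Suc m * orbit_sum bi_u bi_v (\<lambda>y z. y ^ a * z ^ b))"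
    by (rule residue2_step)
  finally show ?case .
qed

section \<open>Lagrange inversion and binomial expansion\<close>

lemma shifted_binomial_nth:
  "((fls_const k + fls_X) ^ N) $$ (int N - int t) = of_nat (N choose t) * k ^ t"
  for k :: "real fls"
proof -
  have "(fls_const k + fls_X) ^ N = (\<Sum>i\<le>N. fls_const (of_nat (N choose i) * k ^ i) * fls_X ^ (N - i))"
    by (simp only: binomial_ring fls_of_nat fls_const_hom)
  also have "\<dots> $$ (int N - int t) = (\<Sum>i\<le>N. if i = t then of_nat (N choose i) * k ^ i else 0)"
    unfolding fls_nth_sum by (rule sum.cong) auto
  also have "\<dots> = of_nat (N choose t) * k ^ t"
    by (subst sum.delta) (auto simp: binomial_eq_0)
  finally show ?thesis .
qed

text \<open>
  After extracting \<open>v^(-N)\<close>, the factor \<open>(u + v)^N\<close> supplies \<open>v^j\<close> and \<open>(1 + u + v)^N\<close> the missing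
  power \<open>v^(N-j-s-1)\<close>.
\<close>

lemma residue_W_power:
  "(W ^ N * (fls_const g * bi_v ^ s)) $$ (-1) =
     (\<Sum>j\<le>N. of_nat ((N choose j) * (N choose (j + s + 1))) * ((1 + inner_X) ^ (N + j + s + 1) / inner_X ^ j) * g)"
proof -
  define x where "x = inner_X"
  define y where "y = 1 + x"
  have x: "x \<noteq> 0" by (simp add: x_def)
  let ?Z = "fls_const y + fls_X"
  have W: "W = fls_const (y / x) * ?Z * (fls_X + fls_const x) * fls_X_inv"
    unfolding W_eq_product bi_y_eq y_def[symmetric] x_def[symmetric] unfolding bi_u_def bi_v_def x_def[symmetric]
    by (simp add: fls_X_inv_eq add.commute divide_inverse fls_inverse_const flip: fls_const_mult_const)
  have nth: "(fls_const k * (F * fls_X ^ t) * fls_X_inv ^ N) $$ (-1) = k * F $$ (int N - int (Suc t))"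
    for k t and F :: "real fls fls"
    unfolding fls_X_inv_power_times_conv_shift fls_X_power_times_conv_shift fls_shift_nth fls_mult_const_nth
    by (simp add: algebra_simps)
  have C: "(fls_X + fls_const x) ^ N = (\<Sum>j\<le>N. fls_const (of_nat (N choose j) * x ^ (N - j)) * fls_X ^ j)"
    unfolding binomial_ring[of fls_X] fls_of_nat by (simp only: fls_const_hom[symmetric]) (simp only: mult_ac)
  have "W ^ N * (fls_const g * bi_v ^ s) =
      fls_const (y ^ N / x ^ N * g) * (?Z ^ N * ((fls_X + fls_const x) ^ N * fls_X ^ s)) * fls_X_inv ^ N"
    by (simp only: W power_mult_distrib fls_const_power[symmetric] power_divide bi_v_def fls_const_mult_const[symmetric])
      (simp only: mult_ac)
  also have "\<dots> = (\<Sum>j\<le>N. fls_const (y ^ N / x ^ N * g * (of_nat (N choose j) * x ^ (N - j))) * (?Z ^ N * fls_X ^ (j + s)) * fls_X_inv ^ N)"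
    unfolding C sum_distrib_left sum_distrib_right
    by (rule sum.cong[OF refl]) (simp only: power_add fls_const_mult_const[symmetric] mult_ac)
  finally have "(W ^ N * (fls_const g * bi_v ^ s)) $$ (-1) = (\<Sum>j\<le>N. y ^ N / x ^ N * g * (of_nat (N choose j) * x ^ (N - j)) * (?Z ^ N) $$ (int N - int (Suc (j + s))))"
    by (simp only: fls_nth_sum nth)
  also have "\<dots> = (\<Sum>j\<le>N. of_nat ((N choose j) * (N choose (j + s + 1))) * (y ^ (N + j + s + 1) / x ^ j) * g)"
  proof (rule sum.cong[OF refl])
    fix j assume "j \<in> {..N}"
    then have "x ^ N = x ^ (N - j) * x ^ j" by (simp flip: power_add)
    then show "y ^ N / x ^ N * g * (of_nat (N choose j) * x ^ (N - j)) * (?Z ^ N) $$ (int N - int (Suc (j + s))) =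
        of_nat ((N choose j) * (N choose (j + s + 1))) * (y ^ (N + j + s + 1) / x ^ j) * g"
      unfolding shifted_binomial_nth using x by (simp add: power_add)
  qed
  finally show ?thesis unfolding y_def x_def .
qed

lemma of_nat_mult_nth: "(of_nat n * f) $$ k = of_nat n * f $$ k"
  for f :: "'a::comm_semiring_1 fls"
  by (simp add: fls_of_nat)

text \<open>
  The residue of a derivative vanishes, so in \<open>- N W' W^(N-1) Q\<close> the derivative may be moved to
  \<open>Q\<close>. The constant coefficient of \<open>Q\<close> disappears, the other three are multiplied by 1, 2 and 3.
\<close>

lemma lagrange_tree_count:
  assumes "N \<ge> 1"
  defines "y \<equiv> 1 + inner_X" and "x \<equiv> inner_X"
  shows "real N * real (tree_count N 1 1) =
    residue2 (W ^ N * (fls_const (y * (1 / x ^ 5 + 2) / x) * bi_v ^ 0))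
    + 2 * residue2 (W ^ N * (fls_const ((- y / x ^ 5 + 1 / x ^ 3 - y / x ^ 2 + 1) / x) * bi_v ^ 1))
    + 3 * residue2 (W ^ N * (fls_const ((1 / x ^ 4 - 1 / x ^ 2) / x) * bi_v ^ 2))"
proof -
  obtain M where N: "N = Suc M" using assms(1) by (cases N) auto
  define g1 where "g1 = y * (1 / x ^ 5 + 2) / x"
  define g2 where "g2 = (- y / x ^ 5 + 1 / x ^ 3 - y / x ^ 2 + 1) / x"
  define g3 where "g3 = (1 / x ^ 4 - 1 / x ^ 2) / x"
  define Q where "Q = fls_const (y ^ 2 / x) + fls_const g1 * bi_v + fls_const g2 * bi_v ^ 2 + fls_const g3 * bi_v ^ 3"
  define T where "T = orbit_sum bi_u bi_v (\<lambda>y z. y ^ 0 * z ^ 0)"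
  have hom: "fls_const (y ^ 2 / x) = (1 + bi_u) ^ 2 / bi_u"
    "fls_const g1 = (1 + bi_u) * (1 / bi_u ^ 5 + 2) / bi_u"
    "fls_const g2 = (- (1 + bi_u) / bi_u ^ 5 + 1 / bi_u ^ 3 - (1 + bi_u) / bi_u ^ 2 + 1) / bi_u"
    "fls_const g3 = (1 / bi_u ^ 4 - 1 / bi_u ^ 2) / bi_u"
    by (simp_all only: g1_def g2_def g3_def y_def x_def bi_u_def fls_const_hom[symmetric] fls_const_uminus
        fls_const_1 fls_const_numeral)
  have distrib: "(a + b * v + c * v ^ 2 + d * v ^ 3) / u = a / u + b / u * v + c / u * v ^ 2 + d / u * v ^ 3"
    for a b c d u v :: "real fls fls"
    by (simp add: add_divide_distrib)
  have "W * T / bi_u = Q"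
    unfolding T_def W_def Q_def hom power_0 mult_1 orbit_sum_one[OF bi_nonzero] by (rule distrib)
  moreover have "- fls_deriv W / bi_u * W ^ N * T = - fls_deriv W * W ^ M * (W * T / bi_u)"
    by (simp add: N)
  ultimately have eq1: "- fls_deriv W / bi_u * W ^ N * T = - fls_deriv W * W ^ M * Q"
    by (simp only:)
  have eq2: "fls_deriv (W ^ N * Q) = of_nat N * (fls_deriv W * W ^ M * Q) + W ^ N * fls_deriv Q"
    unfolding fls_deriv_mult fls_deriv_power N diff_Suc_1 by (simp add: mult_ac del: power_Suc of_nat_Suc)
  have "of_nat N * (- fls_deriv W / bi_u * W ^ N * T) = W ^ N * fls_deriv Q - fls_deriv (W ^ N * Q)"
    unfolding eq1 eq2 by simp
  then have "of_nat N * (- fls_deriv W / bi_u * W ^ N * T) $$ (-1) = (W ^ N * fls_deriv Q) $$ (-1)"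
    by (metis of_nat_mult_nth fls_minus_nth fls_deriv_residue diff_zero)
  then have "real N * residue2 (- fls_deriv W / bi_u * W ^ N * T) = residue2 (W ^ N * fls_deriv Q)"
    unfolding residue2_def by (metis of_nat_mult_nth)
  also have "fls_deriv Q = fls_const g1 * bi_v ^ 0 + of_nat 2 * (fls_const g2 * bi_v ^ 1) + of_nat 3 * (fls_const g3 * bi_v ^ 2)"
    unfolding Q_def bi_v_def by (simp add: fls_deriv_power eval_nat_numeral algebra_simps)
  also have "W ^ N * \<dots> = W ^ N * (fls_const g1 * bi_v ^ 0) + of_nat 2 * (W ^ N * (fls_const g2 * bi_v ^ 1))
      + of_nat 3 * (W ^ N * (fls_const g3 * bi_v ^ 2))"
    by (simp only: distrib_left mult.left_commute)
  also have "residue2 \<dots> = residue2 (W ^ N * (fls_const g1 * bi_v ^ 0)) + 2 * residue2 (W ^ N * (fls_const g2 * bi_v ^ 1))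
      + 3 * residue2 (W ^ N * (fls_const g3 * bi_v ^ 2))"
    unfolding residue2_def fls_plus_nth of_nat_mult_nth by (simp only: of_nat_numeral)
  also have "residue2 (- fls_deriv W / bi_u * W ^ N * T) = real (tree_count N 1 1)"
    using tree_count_eq_residue[of N 0 0] by (simp add: T_def)
  finally show ?thesis unfolding g1_def g2_def g3_def .
qed

lemma residue2_W_power:
  "residue2 (W ^ N * (fls_const g * bi_v ^ s)) =
     (\<Sum>j\<le>N. real ((N choose j) * (N choose (j + s + 1))) * (((1 + inner_X) ^ (N + j + s + 1) / inner_X ^ j) * g) $$ (-1))"
  unfolding residue2_def residue_W_power mult.assoc[of "of_nat _"] by (simp only: fls_nth_sum of_nat_mult_nth)

theorem corollary18:
  fixes n :: nat
  assumes "n \<ge> 2"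
  shows "real (SB n) =
    1 / (real n - 1) *
    (\<Sum>j=0..n. real ((n - 1) choose j) *
      ( real ((n - 1) choose (j + 1)) *
          (real ((n + j + 1) choose (j + 5)) + 2 * real ((n + j + 1) choose j))
      + 2 * real ((n - 1) choose (j + 2)) *
          (- real ((n + j + 2) choose (j + 5)) + real ((n + j + 1) choose (j + 3))
           - real ((n + j + 2) choose (j + 2)) + real ((n + j + 1) choose j))
      + 3 * real ((n - 1) choose (j + 3)) *
          (real ((n + j + 2) choose (j + 4)) - real ((n + j + 2) choose (j + 2)))))"
proof -
  define N where "N = n - 1"
  have N: "N \<ge> 1" "n = Suc N" using assms by (auto simp: N_def)
  have index: "n - 1 = N" "n + j + 1 = N + j + 2" "n + j + 2 = N + j + 3" for j
    using N(2) by auto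
  define x where "x = inner_X"
  define y where "y = 1 + x"
  have x: "x \<noteq> 0" by (simp add: x_def)
  have mono: "(y ^ p / x ^ Suc q) $$ (-1) = real (p choose q)" for p q
    unfolding y_def x_def one_plus_X_power_div_nth by simp
  have r1: "(y ^ (N + j + 0 + 1) / x ^ j * (y * (1 / x ^ 5 + 2) / x)) $$ (-1) =
      real ((N + j + 2) choose (j + 5)) + 2 * real ((N + j + 2) choose j)" for j
  proof -
    have "y ^ (N + j + 0 + 1) / x ^ j * (y * (1 / x ^ 5 + 2) / x) =
        y ^ (N + j + 2) / x ^ Suc (j + 5) + of_nat 2 * (y ^ (N + j + 2) / x ^ Suc j)"
      using x by (simp add: field_simps power_add eval_nat_numeral)
    then show ?thesis by (simp only: fls_plus_nth of_nat_mult_nth mono)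
  qed
  have r2: "(y ^ (N + j + 1 + 1) / x ^ j * ((- y / x ^ 5 + 1 / x ^ 3 - y / x ^ 2 + 1) / x)) $$ (-1) =
      - real ((N + j + 3) choose (j + 5)) + real ((N + j + 2) choose (j + 3))
      - real ((N + j + 3) choose (j + 2)) + real ((N + j + 2) choose j)" for j
  proof -
    have "y ^ (N + j + 1 + 1) / x ^ j * ((- y / x ^ 5 + 1 / x ^ 3 - y / x ^ 2 + 1) / x) =
        - (y ^ (N + j + 3) / x ^ Suc (j + 5)) + y ^ (N + j + 2) / x ^ Suc (j + 3)
        - y ^ (N + j + 3) / x ^ Suc (j + 2) + y ^ (N + j + 2) / x ^ Suc j"
      using x by (simp add: field_simps power_add eval_nat_numeral)
    then show ?thesis by (simp only: fls_plus_nth fls_minus_nth fls_uminus_nth mono)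
  qed
  have r3: "(y ^ (N + j + 2 + 1) / x ^ j * ((1 / x ^ 4 - 1 / x ^ 2) / x)) $$ (-1) =
      real ((N + j + 3) choose (j + 4)) - real ((N + j + 3) choose (j + 2))" for j
  proof -
    have "y ^ (N + j + 2 + 1) / x ^ j * ((1 / x ^ 4 - 1 / x ^ 2) / x) =
        y ^ (N + j + 3) / x ^ Suc (j + 4) - y ^ (N + j + 3) / x ^ Suc (j + 2)"
      using x by (simp add: field_simps power_add eval_nat_numeral)
    then show ?thesis by (simp only: fls_minus_nth mono)
  qed
  let ?t = "\<lambda>j. real (N choose j) *
      ( real (N choose (j + 1)) *
          (real ((N + j + 2) choose (j + 5)) + 2 * real ((N + j + 2) choose j))
      + 2 * real (N choose (j + 2)) *
          (- real ((N + j + 3) choose (j + 5)) + real ((N + j + 2) choose (j + 3))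
           - real ((N + j + 3) choose (j + 2)) + real ((N + j + 2) choose j))
      + 3 * real (N choose (j + 3)) *
          (real ((N + j + 3) choose (j + 4)) - real ((N + j + 3) choose (j + 2))))"
  have "real N * real (SB n) = (\<Sum>j\<le>N. ?t j)"
    using lagrange_tree_count[OF N(1)]
    unfolding N(2) SB_eq_tree_count residue2_W_power x_def[symmetric] y_def[symmetric] r1 r2 r3
      sum_distrib_left sum.distrib[symmetric]
    by (simp add: algebra_simps numeral_eq_Suc)
  also have "\<dots> = (\<Sum>j=0..n. ?t j)"
    by (rule sum.mono_neutral_left) (auto simp: N(2) binomial_eq_0)
  also have "\<dots> = (\<Sum>j=0..n. real ((n - 1) choose j) *
      ( real ((n - 1) choose (j + 1)) *
          (real ((n + j + 1) choose (j + 5)) + 2 * real ((n + j + 1) choose j))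
      + 2 * real ((n - 1) choose (j + 2)) *
          (- real ((n + j + 2) choose (j + 5)) + real ((n + j + 1) choose (j + 3))
           - real ((n + j + 2) choose (j + 2)) + real ((n + j + 1) choose j))
      + 3 * real ((n - 1) choose (j + 3)) *
          (real ((n + j + 2) choose (j + 4)) - real ((n + j + 2) choose (j + 2)))))" (is "_ = ?S")
    unfolding index ..
  finally have "real N * real (SB n) = ?S" .
  moreover have "real n - 1 = real N" "real N \<noteq> 0" using N by auto
  ultimately show ?thesis by (simp add: field_simps)
qed

end
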